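(* Let $n$ be a positive integer and let $\frac{a_1}{b_1} < \frac{a_2}{b_2} < \cdots$ be the Farey sequence of order $n$. If $k < l$ are indices with $$l - k \le \frac{n}{12}\left(1 - \frac{4}{n^{1/3}}\right),$$ then $(a_l - a_k)(b_l - b_k) \ge 0$, i.e. $\frac{a_k}{b_k}$ and $\frac{a_l}{b_l}$ are similarly ordered.
   Context: The Farey sequence of order $n$ is the increasing list of all reduced fractions $\frac{a}{b}$ with $0 \le \frac{a}{b} \le 1$ and $1 \le b \le n$ (including $\frac01$ and $\frac11$), each written in lowest terms, indexed in increasing order. Two fractions $\frac{a}{b}, \frac{a'}{b'}$ in lowest terms are called similarly ordered if $(a'-a)(b'-b) \ge 0$. *)

theory Defs
  imports "HOL-Analysis.Analysis"
begin

definition num :: "rat \<Rightarrow> int" where "num r = fst (quotient_of r)"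
definition den :: "rat \<Rightarrow> int" where "den r = snd (quotient_of r)"

definition farey :: "nat \<Rightarrow> rat list" where
  "farey n = sorted_list_of_set {r::rat. 0 \<le> r \<and> r \<le> 1 \<and> den r \<le> int n}"

end

theory Submission
  imports Defs
begin

text \<open>
  If \<open>a/b < a'/b'\<close> are not similarly ordered, then \<open>a' > a\<close> and \<open>b' < b\<close>, so the fraction
  \<open>y = (a+1)/(b-1)\<close> lies between them. The interval from \<open>a/b\<close> to \<open>y\<close> has length
  \<open>L = (1 + y)/b\<close>, whence \<open>nL \<ge> 1 + y \<ge> 1 + 1/q\<close> for every Farey fraction \<open>p/q\<close> in it.

  Write \<open>L\<close> as a sum of \<open>N\<close> gaps \<open>1/(d d')\<close> with \<open>d + d' > n\<close>. Call a denominator small if it is at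
  most \<open>n/6\<close>. Gaps without small denominators are at most \<open>36/(5n^2)\<close>, and gaps next to a small
  denominator \<open>q\<close> are at most \<open>6/(5nq)\<close>; two neighbouring small fractions are \<open>1/(q q')\<close> apart, which
  bounds the sum of \<open>1/q\<close> over the small ones. Together, \<open>N \<ge> n/12 (nL - 2/q - 2/q')\<close> where \<open>q\<close>
  and \<open>q'\<close> belong to the first and the last small fraction of the interval. This suffices when both
  are at least \<open>Q = n^(1/3)\<close> or when \<open>nL \<ge> 3\<close>. Otherwise at most one fraction has denominator less
  than \<open>Q\<close>, and the loss at that fraction is made up for by the surplus \<open>1/q\<close> in \<open>nL\<close>, using also
  the fractions \<open>p/q \<plusminus> 1/(qm)\<close>, with \<open>m \<le> n\<close> in a fixed residue class modulo \<open>q\<close>.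
\<close>

section \<open>Reduced fractions and the Farey list\<close>

lemma of_rat_num_den: "(of_rat r :: real) = of_int (num r) / of_int (den r)"
proof -
  have "r = of_int (num r) / of_int (den r)"
    unfolding num_def den_def by (metis prod.collapse quotient_of_div)
  then show ?thesis
    by (metis of_rat_divide of_rat_of_int_eq)
qed

lemma den_pos: "0 < den r"
  unfolding den_def by (metis prod.collapse quotient_of_denom_pos)

lemma coprime_num_den: "coprime (num r) (den r)"
  unfolding num_def den_def by (metis prod.collapse quotient_of_coprime)

text \<open>After cross-multiplication, coprimality makes the reduced denominator divide
  \<open>m\<close>.\<close>

lemma den_le:
  assumes "(of_rat r :: real) = of_int c / of_int m" "0 < m"
  shows "den r \<le> m"
proof -
  have "real_of_int (num r * m) = real_of_int (c * den r)"
    using assms den_pos[of r] by (simp add: of_rat_num_den field_simps)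
  then have "num r * m = c * den r" by linarith
  then have "den r dvd num r * m" by simp
  then have "den r dvd m"
    using coprime_num_den[of r] by (simp add: coprime_commute coprime_dvd_mult_right_iff)
  then show ?thesis using assms zdvd_imp_le by blast
qed

text \<open>The numerator \<open>num s * den r - num r * den s\<close> of the difference is a
  positive integer.\<close>

lemma of_rat_diff_ge:
  assumes "r < s"
  shows "1 / (real_of_int (den r) * real_of_int (den s)) \<le> of_rat s - of_rat r"
proof -
  have p: "0 < real_of_int (den r)" "0 < real_of_int (den s)" using den_pos by auto
  have "(of_rat r :: real) < of_rat s" using assms by (simp add: of_rat_less)
  then have "real_of_int (num r * den s) < real_of_int (num s * den r)"
    using p by (simp add: of_rat_num_den field_simps)
  then have "num r * den s + 1 \<le> num s * den r" by linarith
  then have "real_of_int (num r * den s + 1) \<le> real_of_int (num s * den r)"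
    by (simp only: of_int_le_iff)
  then show ?thesis using p by (simp add: of_rat_num_den field_simps)
qed

lemma finite_farey: "finite {r::rat. 0 \<le> r \<and> r \<le> 1 \<and> den r \<le> int n}" (is "finite ?S")
proof -
  have "?S \<subseteq> (\<lambda>(a, b). of_int a / of_int b) ` ({0..int n} \<times> {0..int n})"
  proof
    fix r assume r: "r \<in> ?S"
    have e: "r = of_int (num r) / of_int (den r)"
      unfolding num_def den_def by (metis prod.collapse quotient_of_div)
    have p: "0 < (of_int (den r) :: rat)" using den_pos by simp
    have "0 \<le> (of_int (num r) :: rat) / of_int (den r)" "(of_int (num r) :: rat) / of_int (den r) \<le> 1"
      using r e by auto
    then have "(0 :: rat) \<le> of_int (num r)" "(of_int (num r) :: rat) \<le> of_int (den r)"
      using p by (auto simp: zero_le_divide_iff divide_le_eq)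
    then have "0 \<le> num r" "num r \<le> den r" by auto
    then show "r \<in> (\<lambda>(a, b). of_int a / of_int b) ` ({0..int n} \<times> {0..int n})"
      using e r den_pos[of r] by (intro image_eqI[of _ _ "(num r, den r)"]) auto
  qed
  then show ?thesis by (rule finite_subset) auto
qed

lemma set_farey: "set (farey n) = {r. 0 \<le> r \<and> r \<le> 1 \<and> den r \<le> int n}"
  unfolding farey_def using finite_farey by simp

lemma farey_nth_less_iff:
  assumes "i < length (farey n)" "j < length (farey n)"
  shows "farey n ! i < farey n ! j \<longleftrightarrow> i < j"
proof -
  have "sorted_wrt (<) (farey n)" unfolding farey_def by simp
  then show ?thesis using assms
    by (metis linorder_neqE_nat order_less_asym sorted_wrt_iff_nth_less less_irrefl)
qed

lemma farey_nth_bounds: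
  assumes "i < length (farey n)"
  shows "0 \<le> farey n ! i" "farey n ! i \<le> 1" "den (farey n ! i) \<le> int n"
  using nth_mem[OF assms] set_farey by auto

section \<open>Neighbours of a reduced fraction under a bound on denominators\<close>

text \<open>Modulo \<open>den r\<close> the numerator is a unit, so the admissible \<open>e\<close>
  form one residue class, and any \<open>den r\<close> consecutive integers meet it.\<close>

lemma ex_adjacent_denominator:
  fixes \<sigma> :: int
  assumes "\<sigma> = 1 \<or> \<sigma> = -1"
  shows "\<exists>e. int n - den r < e \<and> e \<le> int n \<and> den r dvd num r * e + \<sigma>"
proof -
  obtain u v where uv: "u * num r + v * den r = 1"
    using coprime_num_den[of r] bezout_int[of "num r" "den r"] by (metis coprime_imp_gcd_eq_1)
  \<comment> \<open>The largest integer up to \<open>n\<close> congruent to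
    \<open>- \<sigma> * u\<close>, where \<open>u\<close> inverts \<open>num r\<close> modulo
    \<open>den r\<close>.\<close>
  define e where "e = int n - (int n + \<sigma> * u) mod den r"
  have m: "0 \<le> (int n + \<sigma> * u) mod den r" "(int n + \<sigma> * u) mod den r < den r"
    using den_pos[of r] by auto
  define K where "K = (int n + \<sigma> * u) div den r"
  have eK: "e = den r * K - \<sigma> * u"
    unfolding e_def K_def by (simp add: minus_mult_div_eq_mod [symmetric])
  have "num r * e + \<sigma> = \<sigma> * (1 - u * num r) + den r * (num r * K)"
    unfolding eK by (simp add: algebra_simps)
  also have "1 - u * num r = v * den r" using uv by simp
  finally have "num r * e + \<sigma> = den r * (\<sigma> * v + num r * K)"
    by (simp add: algebra_simps)
  then have "den r dvd num r * e + \<sigma>" by simp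
  then show ?thesis using m unfolding e_def by (intro exI[of _ e]) (auto simp: e_def)
qed

text \<open>The divisibility lets the factor \<open>den r\<close> cancel from the denominator
  \<open>den r * m\<close> of the sum.\<close>

lemma adjacent_fraction:
  fixes \<sigma> :: int
  assumes "den r dvd num r * m + \<sigma>" "0 < m"
  shows "\<exists>s. (of_rat s :: real) = of_rat r + of_int \<sigma> / (of_int (den r) * of_int m) \<and> den s \<le> m"
proof -
  obtain c where c: "num r * m + \<sigma> = den r * c" using assms by (elim dvdE)
  define s :: rat where "s = of_int c / of_int m"
  have p: "0 < real_of_int (den r)" "0 < real_of_int m" using den_pos assms by auto
  have s: "(of_rat s :: real) = of_int c / of_int m"
    by (simp add: s_def of_rat_divide)
  have "real_of_int (num r * m + \<sigma>) = real_of_int (den r * c)" using c by simp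
  then have "(of_rat s :: real) = of_rat r + of_int \<sigma> / (of_int (den r) * of_int m)"
    unfolding s of_rat_num_den[of r] using p by (simp add: field_simps)
  then show ?thesis using den_le[OF s] assms by blast
qed

text \<open>The neighbour is constructed as \<open>t = r + 1/(q e)\<close> with the largest
  admissible \<open>e\<close>, so \<open>n - q < e \<le> n\<close>; no fraction of order
  \<open>n\<close> fits between \<open>r\<close> and \<open>t\<close>.\<close>

lemma farey_successor:
  assumes "Suc i < length (farey n)"
  defines "r \<equiv> farey n ! i" and "s \<equiv> farey n ! Suc i"
  shows "of_rat s - of_rat r = 1 / (real_of_int (den r) * real_of_int (den s))"
    and "int n < den r + den s"
proof -
  have len: "i < length (farey n)" using assms by simp
  have rs: "r < s" unfolding r_def s_def using farey_nth_less_iff[OF len assms(1)] by simp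
  have s1: "s \<le> 1" unfolding s_def using farey_nth_bounds[OF assms(1)] by simp
  have r0: "0 \<le> r" "den r \<le> int n" unfolding r_def using farey_nth_bounds[OF len] by auto
  obtain e where e: "int n - den r < e" "e \<le> int n" "den r dvd num r * e + 1"
    using ex_adjacent_denominator[of 1 n r] by auto
  have e0: "0 < e" using e r0 by linarith
  obtain t where t: "(of_rat t :: real) = of_rat r + 1 / (of_int (den r) * of_int e)" "den t \<le> e"
    using adjacent_fraction[OF e(3) e0] by auto
  define q f where "q = real_of_int (den r)" and "f = real_of_int e"
  have qf: "0 < q" "1 \<le> f" "real n < q + f"
    using den_pos[of r] e0 e unfolding q_def f_def by linarith+
  have tr: "(of_rat t :: real) = of_rat r + 1 / (q * f)" using t by (simp add: q_def f_def)
  have rt: "r < t"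
  proof -
    have "(of_rat r :: real) < of_rat t" using tr qf by simp
    then show ?thesis by (simp add: of_rat_less)
  qed
  \<comment> \<open>A fraction \<open>r < 1\<close> is at least \<open>1/q\<close> away from
    1.\<close>
  have "t \<le> 1"
  proof -
    have "r < 1" using rs s1 by simp
    from of_rat_diff_ge[OF this] have "1 / q \<le> 1 - of_rat r"
      by (simp add: q_def den_def)
    moreover have "1 / (q * f) \<le> 1 / q" using qf by (simp add: field_simps)
    ultimately have "(of_rat t :: real) \<le> of_rat 1" using tr by simp
    then show ?thesis by (simp only: of_rat_less_eq)
  qed
  then have "t \<in> set (farey n)" using t e rt r0 by (simp add: set_farey)
  then obtain j where j: "j < length (farey n)" "farey n ! j = t" by (auto simp: in_set_conv_nth)
  then have "i < j" using rt farey_nth_less_iff[OF len j(1)] by (simp add: r_def)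
  then have "s \<le> t"
    using farey_nth_less_iff[OF j(1) assms(1)] j unfolding s_def by (metis not_less not_less_eq)
  \<comment> \<open>Such an \<open>s\<close> would cut the gap \<open>1/(q f)\<close> into pieces of
    at least \<open>1/(q m)\<close> and \<open>1/(m f)\<close>, forcing
    \<open>m \<ge> q + f > n\<close>.\<close>
  moreover have "\<not> s < t"
  proof
    assume st: "s < t"
    define m where "m = real_of_int (den s)"
    have m: "0 < m" "m \<le> n"
      using den_pos[of s] farey_nth_bounds(3)[OF assms(1)] unfolding m_def s_def by linarith+
    have "1 / (q * m) \<le> of_rat s - of_rat r" using of_rat_diff_ge[OF rs] by (simp add: q_def m_def)
    moreover have "1 / (m * f) \<le> of_rat t - of_rat s"
    proof -
      have "1 / (m * f) \<le> 1 / (m * real_of_int (den t))"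
        using m t den_pos[of t] qf by (intro divide_left_mono mult_left_mono mult_pos_pos) (auto simp: f_def)
      then show ?thesis using of_rat_diff_ge[OF st] by (simp add: m_def)
    qed
    ultimately have "1 / (q * m) + 1 / (m * f) \<le> 1 / (q * f)" using tr by simp
    moreover have "1 / (q * m) + 1 / (m * f) = (f + q) / (q * m * f)" "1 / (q * f) = m / (q * m * f)"
      using qf m by (auto simp: field_simps)
    ultimately have "(f + q) / (q * m * f) \<le> m / (q * m * f)" by simp
    moreover have "0 < q * m * f" using qf m by simp
    ultimately have "f + q \<le> m" by (simp only: divide_le_cancel)
    then show False using qf m by simp
  qed
  ultimately have st: "s = t" by simp
  \<comment> \<open>So far \<open>den t \<le> e\<close>; the minimal distance between
    \<open>r\<close> and \<open>t\<close> gives the converse.\<close>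
  have "1 / (q * real_of_int (den t)) \<le> 1 / (q * f)"
    using of_rat_diff_ge[OF rt] tr by (simp add: q_def)
  then have "f \<le> of_int (den t)" using qf den_pos[of t] by (simp add: field_simps)
  then have "den t = e" using t(2) by (simp add: f_def)
  then show "of_rat s - of_rat r = 1 / (real_of_int (den r) * real_of_int (den s))"
    and "int n < den r + den s"
    using st tr e by (auto simp: q_def f_def)
qed

text \<open>The fractions counted are \<open>r + \<sigma>/(q m)\<close> for \<open>m = e, e - q, e - 2q, \<dots>\<close>, the largest admissible
  \<open>m\<close> being \<open>e > n - q\<close>.\<close>

lemma farey_adjacent_count:
  fixes \<sigma> :: int and \<delta> :: real
  assumes \<sigma>: "\<sigma> = 1 \<or> \<sigma> = -1" and \<delta>: "0 < \<delta>"
    and fin: "finite M"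
    and mem: "\<And>s. of_int \<sigma> * (of_rat s - of_rat r) \<in> {0<..\<delta>} \<Longrightarrow> den s \<le> int n \<Longrightarrow> s \<in> M"
  defines "q \<equiv> real_of_int (den r)"
  shows "real n / q - 1 / (q\<^sup>2 * \<delta>) - 1 \<le> real (card M)"
proof -
  obtain e where e: "int n - den r < e" "e \<le> int n" "den r dvd num r * e + \<sigma>"
    using ex_adjacent_denominator[OF \<sigma>] by blast
  have q: "1 \<le> q" "real n - q < of_int e" using den_pos[of r] e unfolding q_def by linarith+
  \<comment> \<open>For positive \<open>m = e - u q\<close>, the condition
    \<open>1/(q m) \<le> \<delta>\<close> means exactly \<open>u \<le> w\<close>.\<close>
  define w where "w = (of_int e - 1 / (q * \<delta>)) / q"
  have lw: "real n / q - 1 / (q\<^sup>2 * \<delta>) - 1 \<le> w"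
  proof -
    have "real n / q - 1 / (q\<^sup>2 * \<delta>) - 1 = (real n - q - 1 / (q * \<delta>)) / q"
      using q \<delta> by (simp add: field_simps power2_eq_square)
    also have "\<dots> \<le> w" unfolding w_def using q by (intro divide_right_mono) auto
    finally show ?thesis .
  qed
  show ?thesis
  proof (cases "w < 0")
    case True
    then show ?thesis using lw by simp
  next
    case False
    \<comment> \<open>The indices \<open>0, ..., U\<close> number \<open>U + 1 \<ge> w\<close>, so
      rounding down costs nothing.\<close>
    define U where "U = nat \<lfloor>w\<rfloor>"
    define m where "m u = e - int u * den r" for u
    have mu: "1 / (q * \<delta>) \<le> of_int (m u)" if "u \<le> U" for u
    proof -
      have "real u \<le> w" using that False unfolding U_def by linarith
      then have "real u * q \<le> of_int e - 1 / (q * \<delta>)" using q unfolding w_def by (simp add: field_simps)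
      then show ?thesis by (simp add: m_def q_def)
    qed
    have m0: "0 < m u" if "u \<le> U" for u
    proof -
      have "0 < 1 / (q * \<delta>)" using q \<delta> by simp
      then have "0 < real_of_int (m u)" using mu[OF that] by linarith
      then show ?thesis by simp
    qed
    have "\<exists>s. (of_rat s :: real) = of_rat r + of_int \<sigma> / (q * of_int (m u)) \<and> den s \<le> m u" if "u \<le> U" for u
    proof -
      have "num r * m u + \<sigma> = num r * e + \<sigma> - den r * (num r * int u)"
        by (simp add: m_def algebra_simps)
      then have "den r dvd num r * m u + \<sigma>" using e(3) by (simp only: dvd_diff dvd_triv_left)
      then show ?thesis using adjacent_fraction m0[OF that] unfolding q_def by blast
    qed
    then obtain y where y: "\<And>u. u \<le> U \<Longrightarrow> (of_rat (y u) :: real) = of_rat r + of_int \<sigma> / (q * of_int (m u))"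
      "\<And>u. u \<le> U \<Longrightarrow> den (y u) \<le> m u" by metis
    have "inj_on y {..U}"
    proof (rule inj_onI)
      fix u v assume uv: "u \<in> {..U}" "v \<in> {..U}" "y u = y v"
      have nz: "real_of_int \<sigma> \<noteq> 0" "q \<noteq> 0" using \<sigma> q by auto
      have "of_rat r + of_int \<sigma> / (q * of_int (m u)) = of_rat r + of_int \<sigma> / (q * of_int (m v))"
        using y(1)[of u] y(1)[of v] uv by (metis atMost_iff)
      then have "real_of_int (m u) = of_int (m v)"
        using nz by simp
      then show "u = v" using den_pos[of r] by (simp add: m_def)
    qed
    moreover have "y ` {..U} \<subseteq> M"
    proof (rule image_subsetI)
      fix u assume "u \<in> {..U}"
      then have u: "u \<le> U" by simp
      have mp: "0 < real_of_int (m u)" using m0[OF u] by simp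
      have "of_int \<sigma> * (of_rat (y u) - of_rat r :: real) = 1 / (q * of_int (m u))"
        using \<sigma> y(1)[OF u] by auto
      moreover have "1 / (q * of_int (m u)) \<le> \<delta>" using mu[OF u] q \<delta> mp by (simp add: field_simps)
      moreover have "0 < 1 / (q * of_int (m u))" using q mp by simp
      moreover have "m u \<le> e" using den_pos[of r] by (simp add: m_def)
      ultimately show "y u \<in> M" using mem[of "y u"] y(2)[OF u] e by simp
    qed
    ultimately have "card {..U} \<le> card M" using card_inj_on_le fin by blast
    then have "real U + 1 \<le> card M" by simp
    moreover have "w \<le> real U + 1" unfolding U_def by linarith
    ultimately show ?thesis using lw by linarith
  qed
qed

section \<open>Counting steps in an abstract Farey sequence\<close>

text \<open>Positions \<open>x\<close> and denominators \<open>d\<close> are real, which keeps the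
  estimates free of coercions. The last two assumptions are the counts of fractions
  \<open>p/q + 1/(q m)\<close> right of \<open>x i\<close> and \<open>p/q - 1/(q m)\<close> left of
  \<open>x j\<close>.\<close>

locale farey_walk =
  fixes n :: real and len :: nat and x d :: "nat \<Rightarrow> real"
  assumes n_pos: "0 < n"
    and d_pos: "i < len \<Longrightarrow> 0 < d i"
    and gap: "Suc i < len \<Longrightarrow> x (Suc i) - x i = 1 / (d i * d (Suc i))"
    and d_sum: "Suc i < len \<Longrightarrow> n < d i + d (Suc i)"
    and separated: "i < j \<Longrightarrow> j < len \<Longrightarrow> 1 / (d i * d j) \<le> x j - x i"
    and adjacent_right: "i < j \<Longrightarrow> j < len \<Longrightarrow> n / d i - 1 / ((d i)\<^sup>2 * (x j - x i)) - 1 \<le> real (j - i)"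
    and adjacent_left: "i < j \<Longrightarrow> j < len \<Longrightarrow> n / d j - 1 / ((d j)\<^sup>2 * (x j - x i)) - 1 \<le> real (j - i)"
begin

text \<open>Expanding \<open>(d - n/6) (d' - n/6) > 0\<close> with \<open>d + d' > n\<close> gives
  \<open>d d' > n^2/6 - n^2/36\<close>.\<close>

lemma large_gap:
  assumes "Suc i < len" "n / 6 < d i" "n / 6 < d (Suc i)"
  shows "x (Suc i) - x i \<le> 36 / (5 * n\<^sup>2)"
proof -
  have "0 < (d i - n / 6) * (d (Suc i) - n / 6)" using assms by simp
  moreover have "n / 6 * n < n / 6 * (d i + d (Suc i))" using d_sum assms n_pos by simp
  ultimately have "5 * n\<^sup>2 / 36 \<le> d i * d (Suc i)" by (simp add: field_simps power2_eq_square)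
  moreover have "0 < 5 * n\<^sup>2 / 36" "0 < d i * d (Suc i)" using n_pos assms by auto
  ultimately have "1 / (d i * d (Suc i)) \<le> 1 / (5 * n\<^sup>2 / 36)"
    by (intro divide_left_mono[OF _ _ mult_pos_pos]) auto
  then show ?thesis using gap assms by simp
qed

lemma large_run:
  assumes "i \<le> j" "j < len" "\<And>m. i \<le> m \<Longrightarrow> m \<le> j \<Longrightarrow> n / 6 < d m"
  shows "x j - x i \<le> 36 / (5 * n\<^sup>2) * real (j - i)"
  using assms
proof (induction j rule: dec_induct)
  case (step j)
  then have "x j - x i \<le> 36 / (5 * n\<^sup>2) * real (j - i)" "x (Suc j) - x j \<le> 36 / (5 * n\<^sup>2)"
    using large_gap by auto
  moreover have "real (Suc j - i) = real (j - i) + 1" using step by simp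
  ultimately show ?case by (simp only: distrib_left)
qed simp

text \<open>The partner of a small denominator exceeds \<open>5 n / 6\<close>.\<close>

lemma small_gap:
  assumes "0 < u" "u \<le> n / 6" "n < u + v"
  shows "1 / (u * v) \<le> 6 / (5 * n * u)" "1 / (v * u) \<le> 6 / (5 * n * u)"
proof -
  have "5 * n / 6 < v" using assms by linarith
  then have "1 / (u * v) \<le> 1 / (u * (5 * n / 6))"
    using assms n_pos by (intro divide_left_mono mult_left_mono mult_pos_pos) auto
  then show "1 / (u * v) \<le> 6 / (5 * n * u)" "1 / (v * u) \<le> 6 / (5 * n * u)" by (simp_all add: mult_ac)
qed

lemma large_run_count:
  assumes "i \<le> j" "j < len" "\<And>m. i \<le> m \<Longrightarrow> m \<le> j \<Longrightarrow> n / 6 < d m"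
  shows "5 * n\<^sup>2 / 36 * (x j - x i) \<le> real (j - i)"
  using large_run[OF assms] n_pos by (simp add: field_simps)

text \<open>Large gaps give the rate \<open>5 * n\<^sup>2 / 36\<close>. Only the gap next to the
  small fraction may be longer; giving up its whole length costs at most
  \<open>n / (6 * d i)\<close>.\<close>

lemma right_tail:
  assumes "i \<le> j" "j < len" "d i \<le> n / 6" "\<And>m. i < m \<Longrightarrow> m \<le> j \<Longrightarrow> n / 6 < d m"
  shows "5 * n\<^sup>2 / 36 * (x j - x i) - n / (6 * d i) \<le> real (j - i)"
proof (cases "i = j")
  case True
  then show ?thesis using n_pos d_pos[of i] assms by simp
next
  case False
  have g: "x (Suc i) - x i \<le> 6 / (5 * n * d i)"
    using gap[of i] small_gap(1)[of "d i" "d (Suc i)"] d_sum[of i] d_pos[of i] assms False by simp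
  have r: "5 * n\<^sup>2 / 36 * (x j - x (Suc i)) \<le> real (j - Suc i)"
    using assms False by (intro large_run_count) auto
  have "5 * n\<^sup>2 / 36 * (x (Suc i) - x i) \<le> 5 * n\<^sup>2 / 36 * (6 / (5 * n * d i))"
    using g by (intro mult_left_mono) auto
  also have "\<dots> = n / (6 * d i)" using n_pos by (simp add: power2_eq_square)
  finally have "5 * n\<^sup>2 / 36 * (x (Suc i) - x i) \<le> n / (6 * d i)" .
  with r show ?thesis by (simp add: algebra_simps)
qed

lemma left_tail:
  assumes "i \<le> j" "j < len" "d j \<le> n / 6" "\<And>m. i \<le> m \<Longrightarrow> m < j \<Longrightarrow> n / 6 < d m"
  shows "5 * n\<^sup>2 / 36 * (x j - x i) - n / (6 * d j) \<le> real (j - i)"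
proof (cases "i = j")
  case True
  then show ?thesis using n_pos d_pos[of j] assms by simp
next
  case False
  then obtain h where h: "j = Suc h" "i \<le> h" using assms by (cases j) auto
  have g: "x j - x h \<le> 6 / (5 * n * d j)"
    using gap[of h] small_gap(2)[of "d j" "d h"] d_sum[of h] d_pos[of j] assms h
    by (simp add: add.commute)
  have r: "5 * n\<^sup>2 / 36 * (x h - x i) \<le> real (h - i)"
    using assms h by (intro large_run_count) auto
  have "5 * n\<^sup>2 / 36 * (x j - x h) \<le> 5 * n\<^sup>2 / 36 * (6 / (5 * n * d j))"
    using g by (intro mult_left_mono) auto
  also have "\<dots> = n / (6 * d j)" using n_pos by (simp add: power2_eq_square)
  finally have "5 * n\<^sup>2 / 36 * (x j - x h) \<le> n / (6 * d j)" .
  moreover have "real (h - i) \<le> real (j - i)" using h by simp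
  ultimately show ?thesis using r by (simp add: algebra_simps)
qed

text \<open>The losses at both ends sum to \<open>n/6 (1/q + 1/q') = n/6 (q + q')/(q q')\<close>.
  Since \<open>q + q' \<le> n/3\<close> and \<open>1/(q q')\<close> is at most the distance, this
  lowers the rate from 5/36 by 1/18, to 1/12.\<close>

lemma consecutive_small:
  assumes "i < j" "j < len" "d i \<le> n / 6" "d j \<le> n / 6" "\<And>m. i < m \<Longrightarrow> m < j \<Longrightarrow> n / 6 < d m"
  shows "n\<^sup>2 / 12 * (x j - x i) \<le> real (j - i)"
proof -
  have p: "0 < d i" "0 < d j" using d_pos assms by auto
  \<comment> \<open>Neighbouring denominators sum to more than \<open>n\<close>, so they cannot both
    be small.\<close>
  have ne: "Suc i \<noteq> j" using d_sum[of i] assms n_pos by auto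
  then have sj: "Suc i < j" using assms by simp
  have l: "5 * n\<^sup>2 / 36 * (x j - x (Suc i)) - n / (6 * d j) \<le> real (j - Suc i)"
    using assms sj by (intro left_tail) auto
  \<comment> \<open>A tail of a single step bounds the first gap.\<close>
  have f: "5 * n\<^sup>2 / 36 * (x (Suc i) - x i) - n / (6 * d i) \<le> real (Suc i - i)"
    using assms sj by (intro right_tail) auto
  have t: "5 * n\<^sup>2 / 36 * (x j - x i) - n / 6 * (1 / d i + 1 / d j) \<le> real (j - i)"
  proof -
    have "real (j - i) = real (j - Suc i) + real (Suc i - i)" using sj by simp
    moreover have "n / 6 * (1 / d i + 1 / d j) = n / (6 * d i) + n / (6 * d j)"
      by (simp add: distrib_left)
    moreover have "5 * n\<^sup>2 / 36 * (x j - x i) =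
        5 * n\<^sup>2 / 36 * (x j - x (Suc i)) + 5 * n\<^sup>2 / 36 * (x (Suc i) - x i)"
      by (simp flip: distrib_left)
    ultimately show ?thesis using l f by linarith
  qed
  have "n / 6 * (1 / d i + 1 / d j) \<le> n\<^sup>2 / 18 * (x j - x i)"
  proof -
    have "1 / d i + 1 / d j = (d i + d j) * (1 / (d i * d j))" using p by (simp add: field_simps)
    also have "\<dots> \<le> n / 3 * (1 / (d i * d j))"
      using p assms by (intro mult_right_mono) auto
    also have "\<dots> \<le> n / 3 * (x j - x i)"
      using separated[of i j] assms n_pos by (intro mult_left_mono) auto
    finally have "n / 6 * (1 / d i + 1 / d j) \<le> n / 6 * (n / 3 * (x j - x i))"
      using n_pos by (intro mult_left_mono) auto
    then show ?thesis by (simp add: power2_eq_square)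
  qed
  moreover have "5 * n\<^sup>2 / 36 * (x j - x i) = n\<^sup>2 / 12 * (x j - x i) + n\<^sup>2 / 18 * (x j - x i)"
    by (simp flip: distrib_right)
  ultimately show ?thesis using t by linarith
qed

text \<open>Cut at every small fraction in between and add up
  \<open>consecutive_small\<close>.\<close>

lemma small_small:
  assumes "i \<le> j" "j < len" "d i \<le> n / 6" "d j \<le> n / 6"
  shows "n\<^sup>2 / 12 * (x j - x i) \<le> real (j - i)"
  using assms
proof (induction "j - i" arbitrary: i rule: less_induct)
  case less
  show ?case
  proof (cases "i = j")
    case False
    define h where "h = (LEAST h. i < h \<and> d h \<le> n / 6)"
    have j: "i < j \<and> d j \<le> n / 6" using less False by simp
    then have h: "i < h \<and> d h \<le> n / 6" unfolding h_def by (rule LeastI)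
    have hj: "h \<le> j" unfolding h_def using j by (rule Least_le)
    have "n\<^sup>2 / 12 * (x h - x i) \<le> real (h - i)"
      using h hj less not_less_Least[where P = "\<lambda>h. i < h \<and> d h \<le> n / 6", folded h_def]
      by (intro consecutive_small) (auto simp: not_le)
    moreover have "n\<^sup>2 / 12 * (x j - x h) \<le> real (j - h)"
      using h hj less by (intro less.hyps) auto
    moreover have "real (j - i) = real (j - h) + real (h - i)" using h hj by simp
    ultimately show ?thesis by (simp add: algebra_simps)
  qed simp
qed

lemma x_mono: "i \<le> j \<Longrightarrow> j < len \<Longrightarrow> x i \<le> x j"
proof (cases "i = j")
  case False
  assume "i \<le> j" "j < len"
  then have "0 < 1 / (d i * d j)" "1 / (d i * d j) \<le> x j - x i"
    using False d_pos separated by auto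
  then show ?thesis by linarith
qed simp


text \<open>With \<open>t = q n c\<close>, the claim is trivial for \<open>t \<le> 1\<close>, follows from \<open>line\<close> for \<open>1 \<le> t \<le> 3/2\<close> and
  from \<open>tail\<close> beyond. It loses only half as much at \<open>q\<close> as \<open>tail\<close> does, which is exactly the surplus
  \<open>1/q\<close> of the interval.\<close>

lemma tail_arith:
  fixes q c M :: real
  assumes "0 < q" "0 \<le> c" "0 \<le> M"
    and tail: "5 * n\<^sup>2 / 36 * c - n / (6 * q) \<le> M"
    and line: "0 < c \<Longrightarrow> n / q - 1 / (q\<^sup>2 * c) - 1 \<le> M"
  shows "n\<^sup>2 / 12 * c - n / (12 * q) - 1 \<le> M"
proof -
  define t where "t = q * n * c"
  have c: "n\<^sup>2 * c = n / q * t" using assms by (simp add: t_def power2_eq_square)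
  have nq: "0 < n / q" using n_pos assms by simp
  have eq: "n\<^sup>2 / 12 * c - n / (12 * q) - 1 = n / q * ((t - 1) / 12) - 1"
    using c by (simp add: algebra_simps diff_divide_distrib)
  consider "t \<le> 1" | "1 < t" "t \<le> 3 / 2" | "3 / 2 < t" by linarith
  then show ?thesis
  proof cases
    case 1
    then have "n / q * ((t - 1) / 12) \<le> 0" using nq by (intro mult_nonneg_nonpos) auto
    then show ?thesis using eq assms by linarith
  next
    case 2
    have "0 < c"
      using 2 assms(1,2) n_pos unfolding t_def by (metis less_eq_real_def mult_zero_right not_one_less_zero)
    then have "n / q * (1 - 1 / t) = n / q - 1 / (q\<^sup>2 * c)"
      using assms(1) n_pos by (simp add: t_def power2_eq_square field_simps)
    with line[OF \<open>0 < c\<close>] have "n / q * (1 - 1 / t) - 1 \<le> M" by simp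
    moreover have "(t - 1) / 12 \<le> 1 - 1 / t"
    proof -
      have "0 \<le> (t - 1) * (12 - t)" using 2 by (intro mult_nonneg_nonneg) auto
      then show ?thesis using 2 by (simp add: field_simps)
    qed
    then have "n / q * ((t - 1) / 12) \<le> n / q * (1 - 1 / t)" using nq by (intro mult_left_mono) auto
    ultimately show ?thesis using eq by linarith
  next
    case 3
    \<comment> \<open>The coefficients compare this way precisely from \<open>t = 3/2\<close>
      on.\<close>
    have "n / q * ((t - 1) / 12) \<le> n / q * (5 / 36 * t - 1 / 6)" using nq 3 by (intro mult_left_mono) auto
    also have "\<dots> = 5 / 36 * (n / q * t) - n / (6 * q)" by (simp add: right_diff_distrib)
    also have "\<dots> = 5 * n\<^sup>2 / 36 * c - n / (6 * q)" unfolding c[symmetric] by simp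
    finally show ?thesis using eq tail by linarith
  qed
qed

section \<open>The lower bound for the number of steps\<close>

text \<open>In the application \<open>x l\<close> is the inserted fraction \<open>y\<close>;
  \<open>d2\<close> reflects that 0 and 1 are avoided, and \<open>long\<close> is
  \<open>n L \<ge> 1 + y \<ge> 1 + 1/q\<close>.\<close>

lemma steps_lower_bound:
  assumes "k < l" "l < len" and Q: "4 < Q" "Q ^ 3 = n"
    and d2: "\<And>i. k \<le> i \<Longrightarrow> i \<le> l \<Longrightarrow> 2 \<le> d i"
    and long: "\<And>i. k \<le> i \<Longrightarrow> i \<le> l \<Longrightarrow> 1 + 1 / d i \<le> n * (x l - x k)"
  shows "n / 12 * (1 - 4 / Q) < real (l - k)"
proof -
  define L where "L = x l - x k"
  have nL: "1 < n * L"
  proof -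
    have "0 < 1 / d k" using d_pos[of k] assms by simp
    moreover have "1 + 1 / d k \<le> n * L" using long[of k] assms unfolding L_def by simp
    ultimately show ?thesis by linarith
  qed
  have Q2: "16 < Q\<^sup>2" "n = Q * Q\<^sup>2"
  proof -
    have "4 * 4 < Q * Q" using Q by (intro mult_strict_mono) auto
    then show "16 < Q\<^sup>2" by (simp add: power2_eq_square)
    show "n = Q * Q\<^sup>2" using Q by (simp add: power2_eq_square power3_eq_cube)
  qed
  have n64: "64 < n"
  proof -
    have "4 * 16 < Q * Q\<^sup>2" using Q Q2 by (intro mult_strict_mono) auto
    then show ?thesis using Q2 by simp
  qed
  \<comment> \<open>The allowance \<open>Q\<^sup>2 / 3\<close> is twice the loss
    \<open>n/(6 Q)\<close> caused by an end of denominator \<open>Q\<close>.\<close>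
  have target: "n / 12 * (1 - 4 / Q) = n / 12 - Q\<^sup>2 / 3" using Q2 Q by (simp add: field_simps)
  show ?thesis
  proof (cases "\<exists>m. k \<le> m \<and> m \<le> l \<and> d m \<le> n / 6")
    case False
    then have large: "n / 6 < d m" if "k \<le> m" "m \<le> l" for m using that by force
    have "5 * n\<^sup>2 / 36 * L \<le> real (l - k)"
      unfolding L_def using large_run_count[OF less_imp_le[OF assms(1)] assms(2) large] .
    moreover have "5 * n\<^sup>2 / 36 * L = 5 * n / 36 * (n * L)" by (simp add: power2_eq_square)
    moreover have "5 * n / 36 * 1 \<le> 5 * n / 36 * (n * L)" using nL n_pos by (intro mult_left_mono) auto
    ultimately show ?thesis using target Q2 n_pos by linarith
  next
    case True
    define P where "P m \<longleftrightarrow> k \<le> m \<and> m \<le> l \<and> d m \<le> n / 6" for m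
    \<comment> \<open>The first and the last small fraction cut the walk into two tails and a middle
      part, of lengths \<open>a\<close>, \<open>c\<close> and \<open>g\<close>.\<close>
    define i where "i = (LEAST m. P m)"
    define j where "j = (GREATEST m. P m)"
    have ex: "\<exists>m. P m" using True by (simp add: P_def)
    have bd: "\<And>m. P m \<Longrightarrow> m \<le> l" by (simp add: P_def)
    have Pi: "P i" unfolding i_def using ex by (rule LeastI_ex)
    have Pj: "P j" unfolding j_def using ex bd by (rule GreatestI_ex_nat)
    have first: "i \<le> m" if "P m" for m unfolding i_def using that by (rule Least_le)
    have last: "m \<le> j" if "P m" for m unfolding j_def using that bd by (rule Greatest_le_nat)
    have ij: "k \<le> i" "i \<le> j" "j \<le> l" "d i \<le> n / 6" "d j \<le> n / 6"
      using Pi Pj first[OF Pj] by (auto simp: P_def)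
    define a g c where "a = x i - x k" and "g = x j - x i" and "c = x l - x j"
    have L: "L = a + g + c" by (simp add: L_def a_def g_def c_def)
    have nonneg: "0 \<le> a" "0 \<le> g" "0 \<le> c"
      using x_mono[of k i] x_mono[of i j] x_mono[of j l] ij assms(2) by (auto simp: a_def g_def c_def)
    have di: "2 \<le> d i" "2 \<le> d j" using d2 ij by auto
    have longi: "1 + 1 / d i \<le> n * L" "1 + 1 / d j \<le> n * L" using long ij by (auto simp: L_def)
    have N: "real (l - k) = real (i - k) + real (j - i) + real (l - j)" using ij by simp
    have left: "5 * n\<^sup>2 / 36 * a - n / (6 * d i) \<le> real (i - k)"
      unfolding a_def
    proof (rule left_tail)
      fix m assume "k \<le> m" "m < i"
      then show "n / 6 < d m" using first[of m] ij by (force simp: P_def)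
    qed (use ij assms(2) in auto)
    have mid: "n\<^sup>2 / 12 * g \<le> real (j - i)"
      unfolding g_def using ij assms(2) by (intro small_small) auto
    have right: "5 * n\<^sup>2 / 36 * c - n / (6 * d j) \<le> real (l - j)"
      unfolding c_def
    proof (rule right_tail)
      fix m assume "j < m" "m \<le> l"
      then show "n / 6 < d m" using last[of m] ij by (force simp: P_def)
    qed (use ij assms(2) in auto)
    have lline: "n / d i - 1 / ((d i)\<^sup>2 * a) - 1 \<le> real (i - k)" if "0 < a"
      using that ij assms(2) adjacent_left[of k i] unfolding a_def by (cases "k = i") auto
    have rline: "n / d j - 1 / ((d j)\<^sup>2 * c) - 1 \<le> real (l - j)" if "0 < c"
      using that ij assms(2) adjacent_right[of j l] unfolding c_def by (cases "j = l") auto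
    \<comment> \<open>Versions with half the loss, meant for an end whose denominator is below
      \<open>Q\<close>.\<close>
    have left': "n\<^sup>2 / 12 * a - n / (12 * d i) - 1 \<le> real (i - k)"
      using di nonneg left lline by (intro tail_arith) auto
    have right': "n\<^sup>2 / 12 * c - n / (12 * d j) - 1 \<le> real (l - j)"
      using di nonneg right rline by (intro tail_arith) auto
    have LL: "n\<^sup>2 / 12 * L = n\<^sup>2 / 12 * a + n\<^sup>2 / 12 * g + n\<^sup>2 / 12 * c"
      by (simp add: L algebra_simps)
    have sq: "n\<^sup>2 / 12 * a \<le> 5 * n\<^sup>2 / 36 * a" "n\<^sup>2 / 12 * c \<le> 5 * n\<^sup>2 / 36 * c"
      using nonneg by (auto intro!: mult_right_mono)
    have lower: "n\<^sup>2 / 12 * L - n / (6 * d i) - n / (6 * d j) \<le> real (l - k)"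
      using N left mid right LL sq by linarith
    have nn: "n\<^sup>2 / 12 * L = n / 12 * (n * L)" by (simp add: power2_eq_square)
    have bigd: "n / (6 * u) \<le> Q\<^sup>2 / 6" if "Q \<le> u" for u
    proof -
      have "n / (6 * u) \<le> n / (6 * Q)" using that Q n_pos by (intro divide_left_mono) auto
      also have "\<dots> = Q\<^sup>2 / 6" using Q2 Q by simp
      finally show ?thesis .
    qed
    consider "3 \<le> n * L" | "Q \<le> d i" "Q \<le> d j" | "i = j" "4 \<le> d i" | "i = j" "d i < 4"
      | "i < j" "d i < Q" "d j < Q" "n * L < 3" | "i < j" "d j < Q" "Q \<le> d i" | "i < j" "d i < Q" "Q \<le> d j"
      using ij by linarith
    then show ?thesis
    proof cases
      case 1
      \<comment> \<open>Denominators are at least 2, so both losses together take at most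
        \<open>n / 6\<close> from \<open>3 * n / 12\<close>.\<close>
      have "n / (6 * d i) \<le> n / 12" "n / (6 * d j) \<le> n / 12"
        using di n_pos by (auto simp: field_simps)
      moreover have "n / 12 * 3 \<le> n / 12 * (n * L)" using 1 n_pos by (intro mult_left_mono) auto
      ultimately show ?thesis using lower nn target Q2 by linarith
    next
      case 2
      have "n / 12 * 1 < n / 12 * (n * L)" using nL n_pos by (intro mult_strict_left_mono) auto
      then show ?thesis using lower nn target bigd[OF 2(1)] bigd[OF 2(2)] by linarith
    next
      case 3
      \<comment> \<open>Without a middle part the rate 5/36 holds throughout. For
        \<open>q \<ge> 4\<close> the total is at least \<open>13 n / 144\<close>, just above
        \<open>n / 12\<close>.\<close>
      have g: "g = 0" using 3 by (simp add: g_def)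
      have "5 * n\<^sup>2 / 36 * L = 5 * n\<^sup>2 / 36 * a + 5 * n\<^sup>2 / 36 * c" by (simp add: L g algebra_simps)
      moreover have "n / (3 * d i) = n / (6 * d i) + n / (6 * d i)" by simp
      moreover have "real (j - i) = 0" "n / (6 * d j) = n / (6 * d i)" using 3 by auto
      ultimately have "5 * n\<^sup>2 / 36 * L - n / (3 * d i) \<le> real (l - k)"
        using left right N by linarith
      moreover have "5 * n\<^sup>2 / 36 * L = 5 * n / 36 * (n * L)" by (simp add: power2_eq_square)
      moreover have "5 * n / 36 * (1 + 1 / d i) \<le> 5 * n / 36 * (n * L)"
        using longi n_pos by (intro mult_left_mono) auto
      moreover have "n / 12 \<le> 5 * n / 36 * (1 + 1 / d i) - n / (3 * d i)"
      proof -
        have "n / d i \<le> n / 4" using 3 n_pos by (intro divide_left_mono) auto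
        moreover have "5 * n / 36 * (1 + 1 / d i) = 5 * n / 36 + 5 / 36 * (n / d i)"
          by (simp add: distrib_left)
        moreover have "n / (3 * d i) = 1 / 3 * (n / d i)" by simp
        ultimately show ?thesis using n_pos by linarith
      qed
      ultimately show ?thesis using target Q2 by linarith
    next
      case 4
      \<comment> \<open>the longer of the two sides of the unique small fraction already contains enough adjacent fractions\<close>
      define q where "q = d i"
      have q: "2 \<le> q" "q < 4" using di 4 by (auto simp: q_def)
      have side: "3 / 20 * n - 1 \<le> real (l - k)"
        if h: "L / 2 \<le> h" and M: "n / q - 1 / (q\<^sup>2 * h) - 1 \<le> M" "M \<le> real (l - k)" for h M
      proof -
        have "(1 + 1 / q) / (2 * n) \<le> L / 2" using longi n_pos by (simp add: q_def field_simps)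
        then have hh: "(1 + 1 / q) / (2 * n) \<le> h" using h by linarith
        have pos: "0 < q\<^sup>2 * ((1 + 1 / q) / (2 * n))"
          using q n_pos by (intro mult_pos_pos divide_pos_pos add_pos_pos) auto
        moreover have "q\<^sup>2 * ((1 + 1 / q) / (2 * n)) \<le> q\<^sup>2 * h" using hh by (intro mult_left_mono) auto
        ultimately have "1 / (q\<^sup>2 * h) \<le> 1 / (q\<^sup>2 * ((1 + 1 / q) / (2 * n)))"
          by (intro frac_le) auto
        also have "q\<^sup>2 * ((1 + 1 / q) / (2 * n)) = q * (q + 1) / (2 * n)"
        proof -
          have "q\<^sup>2 * (1 + 1 / q) = q * (q + 1)"
            using q by (simp add: distrib_left power2_eq_square)
          then show ?thesis by (simp only: times_divide_eq_right)
        qed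
        also have "1 / (q * (q + 1) / (2 * n)) = 2 * n / (q * (q + 1))" by simp
        finally have h1: "1 / (q\<^sup>2 * h) \<le> 2 * n / (q * (q + 1))" .
        \<comment> \<open>The product equals \<open>20 (q - 1) - 3 q (q + 1)\<close>, and 3/20 is
          the value of \<open>(q - 1)/(q (q + 1))\<close> at 4.\<close>
        have "0 \<le> (4 - q) * (3 * q - 5)" using q by (intro mult_nonneg_nonneg) auto
        define z where "z = q * (q + 1)"
        have z: "0 < z" using q by (simp add: z_def)
        have "3 * z \<le> 20 * (q - 1)"
          using \<open>0 \<le> (4 - q) * (3 * q - 5)\<close> by (simp add: z_def algebra_simps)
        then have "3 / 20 \<le> (q - 1) / z" using z by (simp add: field_simps)
        then have "n * (3 / 20) \<le> n * ((q - 1) / z)" using n_pos by (intro mult_left_mono) auto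
        also have "n * ((q - 1) / z) = (n * (q + 1) - 2 * n) / (q * (q + 1))"
          by (simp add: z_def algebra_simps)
        also have "\<dots> = n / q - 2 * n / (q * (q + 1))" using q by (simp add: diff_divide_distrib)
        finally show ?thesis using M h1 by linarith
      qed
      have Lac: "L = a + c" using 4 L by (simp add: g_def)
      have Lpos: "0 < L" using nL n_pos by (metis less_trans zero_less_mult_pos zero_less_one)
      have "3 / 20 * n - 1 \<le> real (l - k)"
      proof (cases "a \<le> c")
        case True
        then show ?thesis using side[of c "real (l - j)"] rline Lac Lpos N 4 by (simp add: q_def)
      next
        case False
        then show ?thesis using side[of a "real (i - k)"] lline Lac Lpos N 4 by (simp add: q_def)
      qed
      then show ?thesis using target Q2 n64 by linarith
    next
      case 5
      \<comment> \<open>This case is impossible: two distinct fractions with denominators below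
        \<open>Q\<close> are so far apart that \<open>n < 3 Q^2\<close>, whereas
        \<open>n = Q^3\<close> and \<open>Q > 4\<close>.\<close>
      have "1 / (d i * d j) \<le> g" using separated[of i j] 5 ij assms by (simp add: g_def)
      then have "1 / (d i * d j) \<le> L" using L nonneg by linarith
      then have "n * (1 / (d i * d j)) \<le> n * L" using n_pos by (intro mult_left_mono) auto
      then have "n / (d i * d j) < 3" using 5 by simp
      then have "n < 3 * (d i * d j)" using di by (simp add: pos_divide_less_eq)
      also have "d i * d j < Q * Q" using di 5 by (intro mult_strict_mono) auto
      finally have "n < 3 * Q\<^sup>2" by (simp add: power2_eq_square)
      moreover have "4 * Q\<^sup>2 \<le> n" using Q Q2 by simp
      ultimately show ?thesis using Q2 by linarith
    next
      case 6
      \<comment> \<open>The surplus \<open>n / (12 * d j)\<close> cancels the halved loss at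
        \<open>j\<close>; the loss \<open>Q\<^sup>2 / 6\<close> at \<open>i\<close> and the constant
        1 fit into the allowance.\<close>
      have "n / 12 * (1 + 1 / d j) \<le> n / 12 * (n * L)" using longi n_pos by (intro mult_left_mono) auto
      moreover have "n / 12 * (1 + 1 / d j) = n / 12 + n / (12 * d j)" by (simp add: distrib_left)
      ultimately show ?thesis
        using left mid right' sq LL N nn target Q2 bigd[OF 6(3)] by linarith
    next
      case 7
      have "n / 12 * (1 + 1 / d i) \<le> n / 12 * (n * L)" using longi n_pos by (intro mult_left_mono) auto
      moreover have "n / 12 * (1 + 1 / d i) = n / 12 + n / (12 * d i)" by (simp add: distrib_left)
      ultimately show ?thesis
        using left' mid right sq LL N nn target Q2 bigd[OF 7(3)] by linarith
    qed
  qed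
qed

end

section \<open>The Farey sequence as an instance of the abstract walk\<close>

text \<open>The half-open index ranges have \<open>j - i\<close> elements and omit the fraction
  whose neighbours are to be counted.\<close>

lemma farey_nth_between:
  assumes "i < length (farey n)" "j < length (farey n)" "den s \<le> int n"
  shows "farey n ! i < s \<Longrightarrow> s \<le> farey n ! j \<Longrightarrow> s \<in> (!) (farey n) ` {i<..j}"
    and "farey n ! i \<le> s \<Longrightarrow> s < farey n ! j \<Longrightarrow> s \<in> (!) (farey n) ` {i..<j}"
proof -
  have ex: "\<exists>m<length (farey n). farey n ! m = s" if "farey n ! i \<le> s" "s \<le> farey n ! j"
  proof -
    have "s \<in> set (farey n)"
      using that assms farey_nth_bounds(1)[OF assms(1)] farey_nth_bounds(2)[OF assms(2)]
      by (simp add: set_farey)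
    then show ?thesis by (auto simp: in_set_conv_nth)
  qed
  have cmp: "m < m' \<longleftrightarrow> farey n ! m < farey n ! m'"
    if "m < length (farey n)" "m' < length (farey n)" for m m'
    using farey_nth_less_iff[OF that] by simp
  show "s \<in> (!) (farey n) ` {i<..j}" if h: "farey n ! i < s" "s \<le> farey n ! j"
  proof -
    obtain m where m: "m < length (farey n)" "farey n ! m = s" using ex h by force
    then have "i < m" "\<not> j < m" using cmp[of i m] cmp[of j m] assms h by auto
    then show ?thesis using m by auto
  qed
  show "s \<in> (!) (farey n) ` {i..<j}" if h: "farey n ! i \<le> s" "s < farey n ! j"
  proof -
    obtain m where m: "m < length (farey n)" "farey n ! m = s" using ex h by force
    then have "m < j" "\<not> m < i" using cmp[of m i] cmp[of m j] assms h by auto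
    then show ?thesis using m by auto
  qed
qed

lemma farey_walk_farey:
  assumes "1 \<le> n"
  shows "farey_walk (real n) (length (farey n)) (\<lambda>i. of_rat (farey n ! i)) (\<lambda>i. of_int (den (farey n ! i)))"
proof
  show "0 < real n" using assms by simp
  show "0 < real_of_int (den (farey n ! i))" for i using den_pos by simp
  show "real_of_rat (farey n ! Suc i) - of_rat (farey n ! i) =
      1 / (of_int (den (farey n ! i)) * of_int (den (farey n ! Suc i)))"
    if "Suc i < length (farey n)" for i
    using farey_successor(1)[OF that] .
  show "real n < of_int (den (farey n ! i)) + of_int (den (farey n ! Suc i))"
    if "Suc i < length (farey n)" for i
    using farey_successor(2)[OF that] by linarith
  fix i j assume ij: "i < j" "j < length (farey n)"
  then have lt: "farey n ! i < farey n ! j" using farey_nth_less_iff[of i n j] by simp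
  show "1 / (real_of_int (den (farey n ! i)) * of_int (den (farey n ! j)))
      \<le> of_rat (farey n ! j) - of_rat (farey n ! i)"
    using of_rat_diff_ge[OF lt] .
  define \<delta> :: real where "\<delta> = of_rat (farey n ! j) - of_rat (farey n ! i)"
  have \<delta>: "0 < \<delta>" using lt by (simp add: \<delta>_def of_rat_less)
  have "real n / of_int (den (farey n ! i)) - 1 / ((of_int (den (farey n ! i)))\<^sup>2 * \<delta>) - 1
      \<le> real (card ((!) (farey n) ` {i<..j}))"
  proof (rule farey_adjacent_count[where \<sigma> = 1, OF _ \<delta>])
    fix s assume s: "of_int 1 * (of_rat s - of_rat (farey n ! i)) \<in> {0<..\<delta>}" "den s \<le> int n"
    then have "farey n ! i < s" "s \<le> farey n ! j"
      by (auto simp: \<delta>_def of_rat_less of_rat_less_eq)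
    then show "s \<in> (!) (farey n) ` {i<..j}" using farey_nth_between(1) ij s by simp
  qed auto
  also have "\<dots> \<le> real (j - i)" using card_image_le[of "{i<..j}" "(!) (farey n)"] by simp
  finally show "real n / of_int (den (farey n ! i)) -
      1 / ((of_int (den (farey n ! i)))\<^sup>2 * (of_rat (farey n ! j) - of_rat (farey n ! i))) - 1 \<le> real (j - i)"
    by (simp add: \<delta>_def)
  have "real n / of_int (den (farey n ! j)) - 1 / ((of_int (den (farey n ! j)))\<^sup>2 * \<delta>) - 1
      \<le> real (card ((!) (farey n) ` {i..<j}))"
  proof (rule farey_adjacent_count[where \<sigma> = "-1", OF _ \<delta>])
    fix s assume s: "of_int (- 1) * (of_rat s - of_rat (farey n ! j)) \<in> {0<..\<delta>}" "den s \<le> int n"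
    then have "farey n ! i \<le> s" "s < farey n ! j"
      by (auto simp: \<delta>_def of_rat_less of_rat_less_eq)
    then show "s \<in> (!) (farey n) ` {i..<j}" using farey_nth_between(2) ij s by simp
  qed auto
  also have "\<dots> \<le> real (j - i)" using card_image_le[of "{i..<j}" "(!) (farey n)"] by simp
  finally show "real n / of_int (den (farey n ! j)) -
      1 / ((of_int (den (farey n ! j)))\<^sup>2 * (of_rat (farey n ! j) - of_rat (farey n ! i))) - 1 \<le> real (j - i)"
    by (simp add: \<delta>_def)
qed

section \<open>Pairs that are not similarly ordered\<close>

lemma num_nonneg: "0 \<le> r \<Longrightarrow> 0 \<le> num r"
proof -
  assume "0 \<le> r"
  then have "(0::real) \<le> of_rat r" by simp
  then show ?thesis using den_pos[of r] by (simp add: of_rat_num_den zero_le_divide_iff)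
qed

text \<open>Of the two sign patterns, a smaller numerator over a larger denominator would give
  \<open>s \<le> r\<close>. The other pattern also keeps \<open>r\<close> away from 0 and
  \<open>s\<close> away from 1.\<close>

lemma not_similarly_ordered_bounds:
  assumes rs: "r < s" "0 \<le> r" "s \<le> 1"
    and neg: "(num s - num r) * (den s - den r) < 0"
  shows "1 \<le> num r" "num r < num s" "den s < den r" "s < 1"
proof -
  define a b a' b' where defs: "a = num r" "b = den r" "a' = num s" "b' = den s"
  have p: "0 < b" "0 < b'" using den_pos by (auto simp: defs)
  have a0: "0 \<le> a" using num_nonneg rs by (simp add: defs)
  have "(of_rat r :: real) < of_rat s" using rs by (simp add: of_rat_less)
  then have "real_of_int (a * b') < real_of_int (a' * b)"
    using p unfolding of_rat_num_den defs[symmetric] by (simp add: field_simps)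
  then have lt: "a * b' < a' * b" by linarith
  have "a < a' \<and> b' < b"
  proof (rule ccontr)
    assume "\<not> ?thesis"
    then have "a' < a" "b < b'" using neg by (auto simp: mult_less_0_iff defs)
    then have "a' * b \<le> a * b" "a * b \<le> a * b'"
      using p a0 by (auto intro: mult_right_mono mult_left_mono)
    then show False using lt by linarith
  qed
  then show *: "num r < num s" "den s < den r" by (auto simp: defs)
  \<comment> \<open>\<open>num r = 0\<close> would force \<open>den r = 1\<close>, leaving no room
    for \<open>den s\<close>.\<close>
  have "a \<noteq> 0" using coprime_num_den[of r] * den_pos[of s] by (auto simp: defs)
  then show a1: "1 \<le> num r" using a0 by (simp add: defs)
  have "s \<noteq> 1" using * a1 by (auto simp: num_def)
  then show "s < 1" using rs by simp
qed

theorem theorem7: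
  fixes n k l :: nat
  assumes "n \<ge> 1"
    and "k < l" and "l < length (farey n)"
    and "real (l - k) \<le> real n / 12 * (1 - 4 / real n powr (1/3))"
  shows "(num (farey n ! l) - num (farey n ! k)) * (den (farey n ! l) - den (farey n ! k)) \<ge> 0"
proof (rule ccontr)
  define r s where "r = farey n ! k" and "s = farey n ! l"
  assume "\<not> ?thesis"
  then have neg: "(num s - num r) * (den s - den r) < 0" by (simp add: r_def s_def)
  have rs: "r < s" "0 \<le> r" "s \<le> 1" "den r \<le> int n"
    using farey_nth_less_iff[of k n l] farey_nth_bounds[of k n] farey_nth_bounds[of l n] assms
    by (auto simp: r_def s_def)
  note ord = not_similarly_ordered_bounds[OF rs(1-3) neg]
  define a b where "a = num r" and "b = den r"
  have ab: "1 \<le> a" "2 \<le> b" using ord den_pos[of s] by (auto simp: a_def b_def)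
  define y :: rat where "y = of_int (a + 1) / of_int (b - 1)"
  have y: "(of_rat y :: real) = of_int (a + 1) / of_int (b - 1)"
    unfolding y_def by (simp only: of_rat_divide of_rat_of_int_eq)
  have ry: "(of_rat y :: real) - of_rat r = (1 + of_rat y) / of_int b"
    unfolding y of_rat_num_den[of r] a_def[symmetric] b_def[symmetric]
    using ab by (simp add: field_simps)
  have y0: "0 < (of_rat y :: real)" unfolding y using ab by (intro divide_pos_pos) auto
  then have "0 < (1 + of_rat y :: real) / of_int b" using ab by (intro divide_pos_pos add_pos_pos) auto
  then have "(of_rat r :: real) < of_rat y" using ry by linarith
  then have r_less_y: "r < y" by (simp add: of_rat_less)
  \<comment> \<open>The numerator \<open>a + 1\<close> is at most \<open>num s\<close>, and
    \<open>b - 1\<close> is at least \<open>den s\<close>.\<close>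
  have "(of_rat y :: real) \<le> of_rat s"
  proof -
    have "(a + 1) * den s \<le> num s * (b - 1)"
      using ord ab den_pos[of s] by (intro mult_mono) (auto simp: a_def b_def)
    then have "real_of_int ((a + 1) * den s) \<le> of_int (num s * (b - 1))" by linarith
    then show ?thesis unfolding y of_rat_num_den[of s]
      using ab den_pos[of s] by (simp add: field_simps)
  qed
  then have y_le_s: "y \<le> s" by (simp add: of_rat_less_eq)
  have "den y \<le> b - 1" using den_le[OF y] ab by simp
  then have "den y \<le> int n" using rs by (simp add: b_def)
  then obtain h where h: "k < h" "h \<le> l" "farey n ! h = y"
    using farey_nth_between(1)[of k n l y] r_less_y y_le_s assms by (auto simp: r_def s_def)
  define Q where "Q = real n powr (1/3)"
  have Q3: "Q ^ 3 = real n"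
    using assms unfolding Q_def by (simp add: powr_powr flip: powr_realpow)
  have Q0: "0 < Q" using assms by (simp add: Q_def)
  \<comment> \<open>Otherwise the hypothesis bounds the positive \<open>l - k\<close> by a
    nonpositive number.\<close>
  have "4 < Q"
  proof (rule ccontr)
    assume "\<not> 4 < Q"
    then have "1 - 4 / Q \<le> 0" using Q0 by (simp add: field_simps)
    then have "real n / 12 * (1 - 4 / Q) \<le> 0" by (intro mult_nonneg_nonpos) auto
    then show False using assms by (simp add: Q_def)
  qed
  interpret farey_walk "real n" "length (farey n)" "\<lambda>i. of_rat (farey n ! i)"
    "\<lambda>i. of_int (den (farey n ! i))"
    using assms(1) by (rule farey_walk_farey)
  \<comment> \<open>Strictly between 0 and 1 every denominator is at least 2.\<close>
  have inner: "0 < farey n ! i" "farey n ! i < 1" "farey n ! i \<le> y" if "k \<le> i" "i \<le> h" for i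
  proof -
    have i: "r \<le> farey n ! i" "farey n ! i \<le> y"
      using farey_nth_less_iff[of i n k] farey_nth_less_iff[of h n i] that h assms
      by (auto simp: r_def not_less[symmetric])
    have "0 < r"
    proof -
      have "0 < (of_rat r :: real)" using ab by (simp add: of_rat_num_den a_def b_def)
      then show ?thesis by simp
    qed
    then show "0 < farey n ! i" "farey n ! i < 1" "farey n ! i \<le> y"
      using i y_le_s ord by auto
  qed
  have "real n / 12 * (1 - 4 / Q) < real (h - k)"
  proof (rule steps_lower_bound)
    fix i assume i: "k \<le> i" "i \<le> h"
    define t where "t = farey n ! i"
    have t: "0 < (of_rat t :: real)" "(of_rat t :: real) < 1" "(of_rat t :: real) \<le> of_rat y"
      using inner[OF i] by (auto simp: t_def of_rat_less_eq)
    then have nt: "0 < num t" "num t < den t"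
      using den_pos[of t] by (auto simp: of_rat_num_den zero_less_divide_iff)
    then show "2 \<le> real_of_int (den (farey n ! i))" by (simp add: t_def)
    \<comment> \<open>A positive fraction is at least the reciprocal of its denominator; with
      \<open>t \<le> y\<close> this yields the surplus \<open>1/q\<close>.\<close>
    have "1 / of_int (den t) \<le> (of_rat t :: real)"
      using nt den_pos[of t] unfolding of_rat_num_den by (intro divide_right_mono) auto
    then have "1 + 1 / of_int (den t) \<le> 1 + (of_rat y :: real)" using t by linarith
    also have "\<dots> = of_int b * (of_rat y - of_rat r)" using ry ab by simp
    also have "\<dots> \<le> real n * (of_rat y - of_rat r)"
      using rs \<open>(of_rat r :: real) < of_rat y\<close> by (intro mult_right_mono) (auto simp: b_def)
    finally show "1 + 1 / real_of_int (den (farey n ! i))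
        \<le> real n * (of_rat (farey n ! h) - of_rat (farey n ! k))"
      using h by (simp add: t_def r_def)
  qed (use h assms \<open>4 < Q\<close> Q3 in auto)
  also have "\<dots> \<le> real (l - k)" using h by simp
  finally show False using assms by (simp add: Q_def)
qed

end
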